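(* Let $\Lambda\in\mathcal H$ be of integral type, $\tilde\Lambda\in\mathcal H$ of $\Lambda$-integral type, and $g\in\mathcal H$ a group-like element. Then $\dim L^g_{\mathcal V_{\tilde\Lambda}}=1$ if $g\in{}_{\tilde\Lambda}\mathcal V$, and $\dim L^g_{\mathcal V_{\tilde\Lambda}}=0$ otherwise. Moreover, if $0\neq\phi\in L^g_{\mathcal V_{\tilde\Lambda}}$, then $\tilde\Lambda$ is non-degenerate (so $\mathcal V_{\tilde\Lambda}=\mathcal A_{\tilde\Lambda}$ is a unital algebra) and $\phi$ is a faithful functional on $\mathcal V_{\tilde\Lambda}$. Conversely, if $\mathcal A_{\tilde\Lambda}$ admits a faithful $g$-cointegral, then $\tilde\Lambda$ is non-degenerate.
   Context: $k$ is a field; $\mathcal H$ is a Hopf algebra over $k$ with comultiplication $\Delta$, counit $\varepsilon$, invertible antipode $S$, dual $\mathcal H'$. A group-like element is a non-zero $g$ with $\Delta(g)=g\otimes g$. For $\Lambda\in\mathcal H$, $\mathcal V_\Lambda=\{(\nu\otimes\mathrm{id})\Delta(\Lambda):\nu\in\mathcal H'\}$ and ${}_\Lambda\mathcal V=\{(\mathrm{id}\otimes\nu)\Delta(\Lambda):\nu\in\mathcal H'\}$. A non-zero $\Lambda$ is of integral type if $\Delta(\Lambda)(1\otimes\Lambda)=\Lambda\otimes\Lambda$; for such $\Lambda$, a non-zero $\tilde\Lambda$ is of $\Lambda$-integral type if $\Delta(\tilde\Lambda)(1\otimes\tilde\Lambda)=\Lambda\otimes\tilde\Lambda$, and it is non-degenerate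 if $1\in\mathcal V_{\tilde\Lambda}$. $\mathcal A_{\tilde\Lambda}=\{a\in\mathcal H:\Delta(a)(1\otimes\tilde\Lambda)=b\otimes\tilde\Lambda\text{ for some }b\in\mathcal H\}$ (a left coideal subalgebra containing $\mathcal V_{\tilde\Lambda}$). For a left coideal $V$ (subspace with $\Delta(V)\subset\mathcal H\otimes V$), a $g$-cointegral on $V$ is $\phi\in V'$ with $(\mathrm{id}\otimes\phi)(\Delta(a))=\phi(a)g$ for all $a\in V$; $L^g_V$ is the space of these. A functional $\omega$ on an algebra $\mathcal B$ is faithful if $\omega(ab)=0$ for all $b\in\mathcal B$ implies $a=0$. *)

theory Defs
  imports Complex_Main "HOL-Library.Function_Algebras"
begin

text \<open>Encoding conventions.
  The Hopf algebra H is a type 'h of class ring_1 (its ring structure), with a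
  k-scalar multiplication sc making it a k-vector space and a k-algebra.
  An element of H (x) H is represented by a finite list of pairs (sum of simple
  tensors); two lists represent the same tensor iff every bilinear form H x H -> k
  takes the same value on them (i.e. iff they agree under the canonical pairing
  with (H (x) H)' = Bil(H x H, k), which separates points).  Triple tensors are
  handled likewise with trilinear forms.  The comultiplication returns some
  representative list.\<close>

definition lin_fun :: "('k::field \<Rightarrow> 'h::ab_group_add \<Rightarrow> 'h) \<Rightarrow> ('h \<Rightarrow> 'k) \<Rightarrow> bool" where
  "lin_fun sc f \<longleftrightarrow> (\<forall>x y. f (x + y) = f x + f y) \<and> (\<forall>c x. f (sc c x) = c * f x)"

definition lin_map :: "('k::field \<Rightarrow> 'h::ab_group_add \<Rightarrow> 'h) \<Rightarrow> ('h \<Rightarrow> 'h) \<Rightarrow> bool" where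
  "lin_map sc f \<longleftrightarrow> (\<forall>x y. f (x + y) = f x + f y) \<and> (\<forall>c x. f (sc c x) = sc c (f x))"

definition bilin_form :: "('k::field \<Rightarrow> 'h::ab_group_add \<Rightarrow> 'h) \<Rightarrow> ('h \<Rightarrow> 'h \<Rightarrow> 'k) \<Rightarrow> bool" where
  "bilin_form sc B \<longleftrightarrow> (\<forall>y. lin_fun sc (\<lambda>x. B x y)) \<and> (\<forall>x. lin_fun sc (\<lambda>y. B x y))"

definition trilin_form :: "('k::field \<Rightarrow> 'h::ab_group_add \<Rightarrow> 'h) \<Rightarrow> ('h \<Rightarrow> 'h \<Rightarrow> 'h \<Rightarrow> 'k) \<Rightarrow> bool" where
  "trilin_form sc T \<longleftrightarrow> (\<forall>y z. lin_fun sc (\<lambda>x. T x y z)) \<and> (\<forall>x z. lin_fun sc (\<lambda>y. T x y z))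
      \<and> (\<forall>x y. lin_fun sc (\<lambda>z. T x y z))"

definition tensor_eq :: "('k::field \<Rightarrow> 'h::ab_group_add \<Rightarrow> 'h) \<Rightarrow> ('h \<times> 'h) list \<Rightarrow> ('h \<times> 'h) list \<Rightarrow> bool" where
  "tensor_eq sc s t \<longleftrightarrow> (\<forall>B. bilin_form sc B \<longrightarrow>
      sum_list (map (\<lambda>(x, y). B x y) s) = sum_list (map (\<lambda>(x, y). B x y) t))"

definition tensor3_eq :: "('k::field \<Rightarrow> 'h::ab_group_add \<Rightarrow> 'h) \<Rightarrow> ('h \<times> 'h \<times> 'h) list \<Rightarrow> ('h \<times> 'h \<times> 'h) list \<Rightarrow> bool" where
  "tensor3_eq sc s t \<longleftrightarrow> (\<forall>T. trilin_form sc T \<longrightarrow>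
      sum_list (map (\<lambda>(x, y, z). T x y z) s) = sum_list (map (\<lambda>(x, y, z). T x y z) t))"

definition tensor_mult :: "('h::ring_1 \<times> 'h) list \<Rightarrow> ('h \<times> 'h) list \<Rightarrow> ('h \<times> 'h) list" where
  "tensor_mult s t = concat (map (\<lambda>(x, y). map (\<lambda>(u, v). (x * u, y * v)) t) s)"

definition mult_1_tensor :: "('h::ring_1 \<times> 'h) list \<Rightarrow> 'h \<Rightarrow> ('h \<times> 'h) list" where
  "mult_1_tensor t b = map (\<lambda>(x, y). (x, y * b)) t"

definition hopf_algebra ::
  "('k::field \<Rightarrow> 'h::ring_1 \<Rightarrow> 'h) \<Rightarrow> ('h \<Rightarrow> ('h \<times> 'h) list) \<Rightarrow> ('h \<Rightarrow> 'k) \<Rightarrow> ('h \<Rightarrow> 'h) \<Rightarrow> bool" where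
  "hopf_algebra sc Delta eps S \<longleftrightarrow>
     \<comment> \<open>unital associative k-algebra\<close>
     module sc \<and>  \<comment> \<open>k-vector space (k a field)\<close>
     (\<forall>c a b. sc c (a * b) = sc c a * b \<and> sc c (a * b) = a * sc c b) \<and>
     \<comment> \<open>comultiplication: linear, coassociative, algebra morphism\<close>
     (\<forall>a b. tensor_eq sc (Delta (a + b)) (Delta a @ Delta b)) \<and>
     (\<forall>c a. tensor_eq sc (Delta (sc c a)) (map (\<lambda>(x, y). (sc c x, y)) (Delta a))) \<and>
     (\<forall>a. tensor3_eq sc
        (concat (map (\<lambda>(x, y). map (\<lambda>(u, v). (u, v, y)) (Delta x)) (Delta a)))
        (concat (map (\<lambda>(x, y). map (\<lambda>(u, v). (x, u, v)) (Delta y)) (Delta a)))) \<and>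
     (\<forall>a b. tensor_eq sc (Delta (a * b)) (tensor_mult (Delta a) (Delta b))) \<and>
     tensor_eq sc (Delta 1) [(1, 1)] \<and>
     \<comment> \<open>counit: linear, algebra morphism, counit axioms\<close>
     lin_fun sc eps \<and> eps 1 = 1 \<and> (\<forall>a b. eps (a * b) = eps a * eps b) \<and>
     (\<forall>a. sum_list (map (\<lambda>(x, y). sc (eps x) y) (Delta a)) = a) \<and>
     (\<forall>a. sum_list (map (\<lambda>(x, y). sc (eps y) x) (Delta a)) = a) \<and>
     \<comment> \<open>invertible antipode\<close>
     lin_map sc S \<and> bij S \<and>
     (\<forall>a. sum_list (map (\<lambda>(x, y). S x * y) (Delta a)) = sc (eps a) 1) \<and>
     (\<forall>a. sum_list (map (\<lambda>(x, y). x * S y) (Delta a)) = sc (eps a) 1)"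

definition group_like :: "('k::field \<Rightarrow> 'h::ring_1 \<Rightarrow> 'h) \<Rightarrow> ('h \<Rightarrow> ('h \<times> 'h) list) \<Rightarrow> 'h \<Rightarrow> bool" where
  "group_like sc Delta g \<longleftrightarrow> g \<noteq> 0 \<and> tensor_eq sc (Delta g) [(g, g)]"

definition V_right :: "('k::field \<Rightarrow> 'h::ring_1 \<Rightarrow> 'h) \<Rightarrow> ('h \<Rightarrow> ('h \<times> 'h) list) \<Rightarrow> 'h \<Rightarrow> 'h set" where
  "V_right sc Delta L = {sum_list (map (\<lambda>(x, y). sc (nu x) y) (Delta L)) | nu. lin_fun sc nu}"

definition V_left :: "('k::field \<Rightarrow> 'h::ring_1 \<Rightarrow> 'h) \<Rightarrow> ('h \<Rightarrow> ('h \<times> 'h) list) \<Rightarrow> 'h \<Rightarrow> 'h set" where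
  "V_left sc Delta L = {sum_list (map (\<lambda>(x, y). sc (nu y) x) (Delta L)) | nu. lin_fun sc nu}"

definition integral_type :: "('k::field \<Rightarrow> 'h::ring_1 \<Rightarrow> 'h) \<Rightarrow> ('h \<Rightarrow> ('h \<times> 'h) list) \<Rightarrow> 'h \<Rightarrow> bool" where
  "integral_type sc Delta L \<longleftrightarrow> L \<noteq> 0 \<and> tensor_eq sc (mult_1_tensor (Delta L) L) [(L, L)]"

definition rel_integral_type ::
  "('k::field \<Rightarrow> 'h::ring_1 \<Rightarrow> 'h) \<Rightarrow> ('h \<Rightarrow> ('h \<times> 'h) list) \<Rightarrow> 'h \<Rightarrow> 'h \<Rightarrow> bool" where
  "rel_integral_type sc Delta L Lt \<longleftrightarrow> Lt \<noteq> 0 \<and> tensor_eq sc (mult_1_tensor (Delta Lt) Lt) [(L, Lt)]"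

definition non_degenerate :: "('k::field \<Rightarrow> 'h::ring_1 \<Rightarrow> 'h) \<Rightarrow> ('h \<Rightarrow> ('h \<times> 'h) list) \<Rightarrow> 'h \<Rightarrow> bool" where
  "non_degenerate sc Delta Lt \<longleftrightarrow> 1 \<in> V_right sc Delta Lt"

definition A_alg :: "('k::field \<Rightarrow> 'h::ring_1 \<Rightarrow> 'h) \<Rightarrow> ('h \<Rightarrow> ('h \<times> 'h) list) \<Rightarrow> 'h \<Rightarrow> 'h set" where
  "A_alg sc Delta Lt = {a. \<exists>b. tensor_eq sc (mult_1_tensor (Delta a) Lt) [(b, Lt)]}"

text \<open>The dual V' of a subspace V of H is represented by functions H -> k that are
  linear on V and vanish outside V (so that V' is a set of functions in bijection
  with the algebraic dual of V).\<close>
definition dual_sub :: "('k::field \<Rightarrow> 'h::ab_group_add \<Rightarrow> 'h) \<Rightarrow> 'h set \<Rightarrow> ('h \<Rightarrow> 'k) set" where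
  "dual_sub sc V = {phi. (\<forall>x\<in>V. \<forall>y\<in>V. phi (x + y) = phi x + phi y) \<and>
                         (\<forall>c. \<forall>x\<in>V. phi (sc c x) = c * phi x) \<and> (\<forall>x. x \<notin> V \<longrightarrow> phi x = 0)}"

text \<open>L^g_V: g-cointegrals on a left coideal V.  For a in V, Delta(a) lies in H (x) V,
  so (id (x) phi) Delta(a) is computed via any linear extension psi of phi to H
  (the result does not depend on the extension).\<close>
definition cointegrals ::
  "('k::field \<Rightarrow> 'h::ring_1 \<Rightarrow> 'h) \<Rightarrow> ('h \<Rightarrow> ('h \<times> 'h) list) \<Rightarrow> 'h \<Rightarrow> 'h set \<Rightarrow> ('h \<Rightarrow> 'k) set" where
  "cointegrals sc Delta g V = {phi \<in> dual_sub sc V.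
      \<forall>psi. lin_fun sc psi \<and> (\<forall>x\<in>V. psi x = phi x) \<longrightarrow>
        (\<forall>a\<in>V. sum_list (map (\<lambda>(x, y). sc (psi y) x) (Delta a)) = sc (phi a) g)}"

definition faithful_on :: "('h::ring_1 \<Rightarrow> 'k::field) \<Rightarrow> 'h set \<Rightarrow> bool" where
  "faithful_on omega B \<longleftrightarrow> (\<forall>a\<in>B. (\<forall>b\<in>B. omega (a * b) = 0) \<longrightarrow> a = 0)"

definition fscale :: "'k::field \<Rightarrow> ('h \<Rightarrow> 'k) \<Rightarrow> ('h \<Rightarrow> 'k)" where
  "fscale c f = (\<lambda>x. c * f x)"

end

theory Submission
  imports Defs
begin

text \<open>Write \<open>L\<close> for \<open>Lt\<close>, \<open>V\<close> for \<open>V_right\<close> and \<open>A\<close> for \<open>A_alg\<close> of \<open>L\<close>. A functional \<open>phi\<close> on \<open>V\<close> is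
  determined by \<open>w = (id \<otimes> phi) \<Delta>(L)\<close>, and it is a \<open>g\<close>-cointegral iff \<open>\<Delta>(w) = w \<otimes> g\<close>, that is, iff \<open>w\<close>
  is a multiple of \<open>g\<close>; this gives the dimension formula.

  If \<open>\<Delta>(a)(1 \<otimes> L) = b \<otimes> L\<close>, then \<open>(1 \<otimes> a) \<Delta>(L) = (S(b) \<otimes> 1) \<Delta>(L)\<close>. Hence \<open>A V \<subseteq> V\<close>, and \<open>A\<close> acts
  faithfully on the finite-dimensional space \<open>V\<close>, so it is finite-dimensional. Applying \<open>id \<otimes> phi\<close> for
  \<open>phi\<close> with \<open>w = g\<close> gives \<open>S(b) g\<close> on the right, so \<open>phi(a V) = 0\<close> forces \<open>b = 0\<close> and then \<open>a = 0\<close>.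
  Thus \<open>A\<close> embeds into the dual of \<open>V \<subseteq> A\<close>, whence \<open>V = A\<close> contains \<open>1\<close> and \<open>phi\<close> is faithful.

  Conversely, \<open>A L\<close> is spanned by \<open>L\<close>, so a faithful cointegral on the finite-dimensional algebra \<open>A\<close>
  cannot vanish at \<open>L\<close>, and then \<open>g\<close> is a multiple of \<open>(id \<otimes> phi) \<Delta>(L)\<close>.\<close>

section \<open>Linear functionals\<close>

lemma lin_funD:
  assumes "lin_fun sc f"
  shows "f (x + y) = f x + f y" "f (sc c x) = c * f x"
  using assms by (auto simp: lin_fun_def)

lemma bilin_form_left_fun:
  assumes "bilin_form sc B"
  shows "B (x + y) = (\<lambda>z. B x z + B y z)" "B (sc c x) = (\<lambda>z. c * B x z)"
  using assms by (auto simp: bilin_form_def lin_fun_def)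

context vector_space
begin

lemma lin_fun_iff_linear: "lin_fun scale f \<longleftrightarrow> Vector_Spaces.linear scale (*) f"
proof -
  have "vector_space ((*) :: 'a \<Rightarrow> 'a \<Rightarrow> 'a)"
    by unfold_locales (simp_all add: algebra_simps)
  then show ?thesis
    by (simp add: lin_fun_def Vector_Spaces.linear_iff vector_space_axioms)
qed

lemma lin_fun_zero: "lin_fun scale f \<Longrightarrow> f 0 = 0"
  using lin_funD(2)[of scale f 0 0] by simp

lemma lin_fun_diff: "lin_fun scale f \<Longrightarrow> f (x - y) = f x - f y"
  using lin_funD(1)[of scale f "x - y" y] by simp

lemma lin_fun_sum: "lin_fun scale f \<Longrightarrow> f (sum h A) = (\<Sum>a\<in>A. f (h a))"
  by (induction A rule: infinite_finite_induct) (simp_all add: lin_fun_zero lin_funD)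

lemma lin_fun_sum_list: "lin_fun scale f \<Longrightarrow> f (sum_list xs) = sum_list (map f xs)"
  by (induction xs) (simp_all add: lin_fun_zero lin_funD)

text \<open>Prescribe values on a basis of \<open>V\<close> and extend. This turns members of
  \<open>dual_sub\<close>, which are linear only on \<open>V\<close>, into functionals on the whole
  space.\<close>

lemma lin_fun_extend_subspace:
  assumes V: "subspace V"
    and add: "\<And>x y. x \<in> V \<Longrightarrow> y \<in> V \<Longrightarrow> phi (x + y) = phi x + phi y"
    and scale: "\<And>c x. x \<in> V \<Longrightarrow> phi (scale c x) = c * phi x"
  obtains psi where "lin_fun scale psi" "\<And>x. x \<in> V \<Longrightarrow> psi x = phi x"
proof -
  obtain E where E: "E \<subseteq> V" "independent E" "V \<subseteq> span E"
    using maximal_independent_subset by blast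
  interpret pair: vector_space_pair scale "(*) :: 'a \<Rightarrow> 'a \<Rightarrow> 'a"
    by unfold_locales (simp_all add: algebra_simps)
  obtain psi where "Vector_Spaces.linear scale (*) psi" and eq: "\<forall>x\<in>E. psi x = phi x"
    using pair.linear_independent_extend[OF E(2), of phi] by blast
  then have lin: "lin_fun scale psi"
    by (simp add: lin_fun_iff_linear)
  \<comment> \<open>Membership in \<open>V\<close> is carried through the induction because
    \<open>phi\<close> is additive only there.\<close>
  have "x \<in> V \<and> psi x = phi x" if "x \<in> span E" for x
    using that
  proof (induction rule: span_induct)
    case base
    show ?case
      unfolding subspace_def mem_Collect_eq
      using V add scale lin_funD[OF lin] scale[of 0 0] lin_fun_zero[OF lin]
      by (auto simp: subspace_add subspace_scale subspace_0)
  next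
    case (step x)
    then show ?case using E eq by blast
  qed
  then show thesis using that lin E(3) by blast
qed

lemma lin_fun_exists:
  assumes "x \<noteq> 0"
  obtains f where "lin_fun scale f" "f x = 1"
proof -
  interpret pair: vector_space_pair scale "(*) :: 'a \<Rightarrow> 'a \<Rightarrow> 'a"
    by unfold_locales (simp_all add: algebra_simps)
  have "independent {x}" using assms by simp
  then show thesis
    using pair.linear_independent_extend[of "{x}" "\<lambda>_. 1"] that lin_fun_iff_linear by auto
qed

lemma eq_if_lin_fun_eq:
  assumes "\<And>f. lin_fun scale f \<Longrightarrow> f x = f y"
  shows "x = y"
proof (rule ccontr)
  assume "x \<noteq> y"
  then obtain f where "lin_fun scale f" "f (x - y) = 1"
    using lin_fun_exists[of "x - y"] by auto
  with assms[of f] show False by (simp add: lin_fun_diff)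
qed

text \<open>Each functional lowers the dimension by at most one: the space is spanned by the kernel
  of \<open>f i\<close> and a single vector outside it. Every bound on the dimension of
  \<open>A_alg\<close> below comes from here, by comparison with an independent set.\<close>

lemma finite_span_if_lin_funs_separate:
  assumes "finite I" "subspace A"
    and "\<And>i. i \<in> I \<Longrightarrow> lin_fun scale (f i)"
    and "\<And>a. a \<in> A \<Longrightarrow> (\<And>i. i \<in> I \<Longrightarrow> f i a = 0) \<Longrightarrow> a = 0"
  shows "\<exists>E. finite E \<and> card E \<le> card I \<and> A \<subseteq> span E"
  using assms
proof (induction I arbitrary: A rule: finite_induct)
  case empty
  then have "A \<subseteq> span {}" by auto
  then show ?case by (metis card.empty finite.emptyI le_refl)
next
  case (insert i I)
  note lin = insert.prems(2)[of i, simplified]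
  define A0 where "A0 = {a \<in> A. f i a = 0}"
  have "subspace A0"
    using insert.prems(1) lin_funD[OF lin] lin_fun_zero[OF lin]
    by (auto simp: A0_def subspace_def)
  moreover have "a = 0" if "a \<in> A0" "\<And>j. j \<in> I \<Longrightarrow> f j a = 0" for a
    using that insert.prems(3)[of a] by (auto simp: A0_def)
  ultimately obtain E where E: "finite E" "card E \<le> card I" "A0 \<subseteq> span E"
    using insert.IH[of A0] insert.prems(2) by blast
  show ?case
  proof (cases "A0 = A")
    case True
    then show ?thesis using E insert.hyps by (intro exI[of _ E]) auto
  next
    case False
    then obtain a0 where a0: "a0 \<in> A" "f i a0 \<noteq> 0" by (auto simp: A0_def)
    have "a \<in> span (insert a0 E)" if "a \<in> A" for a
    proof -
      have "a - scale (f i a / f i a0) a0 \<in> A0"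
        using that a0 insert.prems(1) lin
        by (auto simp: A0_def lin_fun_diff lin_funD subspace_diff subspace_scale)
      then show ?thesis using E(3) by (auto simp: span_insert)
    qed
    moreover have "card (insert a0 E) \<le> card (insert i I)"
      using E insert.hyps by (simp add: card_insert_if)
    ultimately show ?thesis using E(1) by (intro exI[of _ "insert a0 E"]) auto
  qed
qed

lemma coordinate_lin_fun:
  assumes "independent U" "span U = UNIV"
  shows "lin_fun scale (\<lambda>x. representation U x e)"
  using linear_representation[OF assms] by (simp add: lin_fun_iff_linear)

text \<open>Coordinates are taken in a basis of the whole space, so that they are linear everywhere;
  on \<open>span E\<close> they agree with the coordinates in \<open>E\<close>.\<close>

lemma lin_funs_separate_finite_span:
  assumes "finite E" "independent E"
  obtains f where "\<And>e. lin_fun scale (f e)"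
    "\<And>v. v \<in> span E \<Longrightarrow> (\<And>e. e \<in> E \<Longrightarrow> f e v = 0) \<Longrightarrow> v = 0"
proof
  define U where "U = extend_basis E"
  have U: "independent U" "span U = UNIV" "E \<subseteq> U"
    using assms(2) by (auto simp: U_def independent_extend_basis extend_basis_superset)
  show "lin_fun scale (\<lambda>x. representation U x e)" for e
    using U by (rule_tac coordinate_lin_fun) auto
  show "v = 0" if v: "v \<in> span E" "\<And>e. e \<in> E \<Longrightarrow> representation U v e = 0" for v
  proof -
    have "representation U v = representation E v"
      using representation_extend[OF U(1) v(1) U(3)] .
    then have "(\<Sum>e\<in>E. scale (representation E v e) e) = 0"
      using v(2) by (intro sum.neutral) simp
    then show ?thesis
      using sum_representation_eq[OF assms(2) v(1) assms(1) subset_refl] by simp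
  qed
qed

text \<open>Rank-one forms detect a non-zero tensor: expanding the first legs in a basis writes any
  \<open>B\<close>, on the pairs of the list, as a finite sum of products of functionals.\<close>

lemma tensor_eq_Nil_if_products:
  assumes "\<And>mu f. lin_fun scale mu \<Longrightarrow> lin_fun scale f \<Longrightarrow>
      sum_list (map (\<lambda>(x, y). mu x * f y) xs) = 0"
  shows "tensor_eq scale xs []"
  unfolding tensor_eq_def
proof (intro allI impI)
  fix B :: "'b \<Rightarrow> 'b \<Rightarrow> 'a"
  assume B: "bilin_form scale B"
  define U where "U = extend_basis {}"
  have U: "independent U" "span U = UNIV"
    using independent_empty by (auto simp: U_def independent_extend_basis)
  let ?R = "representation U"
  \<comment> \<open>Only finitely many basis vectors occur in the first legs, so one finite index
    set serves all pairs.\<close>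
  define E where "E = (\<Union>x\<in>fst ` set xs. {e. ?R x e \<noteq> 0})"
  have "finite E" by (auto simp: E_def finite_representation)
  have expand: "B x y = (\<Sum>e\<in>E. ?R x e * B e y)" if "(x, y) \<in> set xs" for x y
  proof -
    have "{e. ?R x e \<noteq> 0} \<subseteq> E" using that by (force simp: E_def)
    then have "(\<Sum>e\<in>E. scale (?R x e) e) = (\<Sum>e | ?R x e \<noteq> 0. scale (?R x e) e)"
      using \<open>finite E\<close> by (intro sum.mono_neutral_right) auto
    also have "\<dots> = x" using sum_nonzero_representation_eq[of U x] U by simp
    finally have "B x y = B (\<Sum>e\<in>E. scale (?R x e) e) y" by simp
    also have "\<dots> = (\<Sum>e\<in>E. ?R x e * B e y)"
      using B lin_fun_sum[of "\<lambda>x. B x y" _ E]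
      by (simp add: bilin_form_def) (simp add: lin_fun_def)
    finally show ?thesis .
  qed
  have "sum_list (map (\<lambda>(x, y). B x y) xs)
      = sum_list (map (\<lambda>(x, y). \<Sum>e\<in>E. ?R x e * B e y) xs)"
    using expand by (intro arg_cong[of _ _ sum_list] map_cong) auto
  also have "\<dots> = (\<Sum>e\<in>E. sum_list (map (\<lambda>(x, y). ?R x e * B e y) xs))"
    by (induction xs) (auto simp: sum.distrib)
  also have "\<dots> = 0"
    using B by (intro sum.neutral ballI assms coordinate_lin_fun U) (auto simp: bilin_form_def)
  finally show "sum_list (map (\<lambda>(x, y). B x y) xs) = sum_list (map (\<lambda>(x, y). B x y) [])"
    by simp
qed

end

section \<open>Hopf algebras\<close>

locale hopf = vector_space sc
  for sc :: "'k::field \<Rightarrow> 'h::ring_1 \<Rightarrow> 'h" +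
  fixes Delta :: "'h \<Rightarrow> ('h \<times> 'h) list" and eps :: "'h \<Rightarrow> 'k" and S :: "'h \<Rightarrow> 'h"
  assumes hopf: "hopf_algebra sc Delta eps S"
begin

text \<open>\<open>sw a (\<lambda>x y. B x y)\<close> renders \<open>B(a\<^sub>1, a\<^sub>2)\<close> in Sweedler notation. Identities in the
  algebra itself are tested against all linear functionals, so that \<open>B\<close> is always scalar valued.\<close>

definition sw :: "'h \<Rightarrow> ('h \<Rightarrow> 'h \<Rightarrow> 'k) \<Rightarrow> 'k" where
  "sw a B = sum_list (map (\<lambda>(x, y). B x y) (Delta a))"

lemma sc_mult: "sc c a * b = sc c (a * b)" "a * sc c b = sc c (a * b)"
  using hopf unfolding hopf_algebra_def by metis+

lemma S_lin: "S (x + y) = S x + S y" "S (sc c x) = sc c (S x)"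
  using hopf by (auto simp: hopf_algebra_def lin_map_def)

lemma bij_S: "bij S"
  using hopf by (auto simp: hopf_algebra_def)

lemma eps_lin_fun: "lin_fun sc eps"
  using hopf by (auto simp: hopf_algebra_def)

lemmas eps_lin = lin_funD[OF eps_lin_fun]

lemma eps_one: "eps 1 = 1" and eps_mult: "eps (a * b) = eps a * eps b"
  using hopf by (auto simp: hopf_algebra_def)

lemma sw_fun_add: "sw a (\<lambda>x y. F x y + G x y) = sw a F + sw a G"
  unfolding sw_def by (induction "Delta a") (auto simp: sum_list_addf case_prod_unfold)

lemma sw_fun_mult: "sw a (\<lambda>x y. c * F x y) = c * sw a F"
  unfolding sw_def by (simp add: sum_list_const_mult case_prod_unfold)

lemma sw_fun_mult_right: "sw a (\<lambda>x y. F x y * c) = sw a F * c"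
  using sw_fun_mult[of a c F] by (simp add: mult.commute)

lemma sw_swap:
  "sw a (\<lambda>x y. sw b (\<lambda>u v. F x y u v)) = sw b (\<lambda>u v. sw a (\<lambda>x y. F x y u v))"
proof -
  have "sum_list (map (\<lambda>p. sum_list (map (\<lambda>q. G p q) qs)) ps)
      = sum_list (map (\<lambda>q. sum_list (map (\<lambda>p. G p q) ps)) qs)"
    for G :: "'h \<times> 'h \<Rightarrow> 'h \<times> 'h \<Rightarrow> 'k" and ps qs
    by (induction ps) (simp_all add: sum_list_addf)
  from this[where G="\<lambda>p q. F (fst p) (snd p) (fst q) (snd q)"]
  show ?thesis by (simp add: sw_def case_prod_unfold)
qed

lemma sw_add: "bilin_form sc B \<Longrightarrow> sw (a + b) B = sw a B + sw b B"
  using hopf by (simp add: hopf_algebra_def tensor_eq_def sw_def)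

lemma sw_scale: "bilin_form sc B \<Longrightarrow> sw (sc c a) B = c * sw a B"
proof -
  assume B: "bilin_form sc B"
  then have "sw (sc c a) B = sum_list (map (\<lambda>(x, y). B x y) (map (\<lambda>(x, y). (sc c x, y)) (Delta a)))"
    using hopf by (simp add: hopf_algebra_def tensor_eq_def sw_def)
  also have "\<dots> = sw a (\<lambda>x y. c * B x y)"
    using B by (simp add: sw_def bilin_form_def lin_fun_def comp_def case_prod_unfold)
  finally show ?thesis by (simp add: sw_fun_mult)
qed

text \<open>Discharges by simplification the multilinearity side conditions of the Sweedler
  rules.\<close>

lemmas linearity = lin_fun_def bilin_form_def trilin_form_def lin_map_def sc_mult S_lin eps_lin
  sw_fun_add sw_fun_mult sw_add sw_scale algebra_simps

lemma sw_mult: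
  assumes "bilin_form sc B"
  shows "sw (a * b) B = sw a (\<lambda>x y. sw b (\<lambda>u v. B (x * u) (y * v)))"
proof -
  have "sum_list (map (\<lambda>(x, y). B x y) (tensor_mult s t))
     = sum_list (map (\<lambda>(x, y). sum_list (map (\<lambda>(u, v). B (x * u) (y * v)) t)) s)" for s t
    by (induction s) (auto simp: tensor_mult_def comp_def case_prod_unfold)
  then show ?thesis
    using hopf assms by (simp add: hopf_algebra_def tensor_eq_def sw_def)
qed

lemma sw_one: "bilin_form sc B \<Longrightarrow> sw 1 B = B 1 1"
  using hopf by (simp add: hopf_algebra_def tensor_eq_def sw_def)

lemma sw_coassoc:
  assumes "trilin_form sc T"
  shows "sw a (\<lambda>x y. sw x (\<lambda>u v. T u v y)) = sw a (\<lambda>x y. sw y (\<lambda>u v. T x u v))"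
proof -
  have "sum_list (map (\<lambda>(x, y, z). T x y z) (concat (map (\<lambda>(x, y). map (\<lambda>(u, v). (u, v, y)) (Delta x)) s)))
     = sum_list (map (\<lambda>(x, y). sum_list (map (\<lambda>(u, v). T u v y) (Delta x))) s)"
    "sum_list (map (\<lambda>(x, y, z). T x y z) (concat (map (\<lambda>(x, y). map (\<lambda>(u, v). (x, u, v)) (Delta y)) s)))
     = sum_list (map (\<lambda>(x, y). sum_list (map (\<lambda>(u, v). T x u v) (Delta y))) s)" for s
    by (induction s) (auto simp: comp_def case_prod_unfold)
  moreover have "tensor3_eq sc (concat (map (\<lambda>(x, y). map (\<lambda>(u, v). (u, v, y)) (Delta x)) (Delta a)))
      (concat (map (\<lambda>(x, y). map (\<lambda>(u, v). (x, u, v)) (Delta y)) (Delta a)))"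
    using hopf unfolding hopf_algebra_def by blast
  ultimately show ?thesis
    using assms unfolding tensor3_eq_def sw_def by metis
qed

lemma lin_fun_sw:
  assumes "lin_fun sc f"
  shows "f (sum_list (map (\<lambda>(x, y). h x y) (Delta a))) = sw a (\<lambda>x y. f (h x y))"
  by (simp add: sw_def lin_fun_sum_list[OF assms] comp_def case_prod_unfold)

lemma sw_counit:
  assumes "lin_fun sc f"
  shows "sw a (\<lambda>x y. eps x * f y) = f a" "sw a (\<lambda>x y. eps y * f x) = f a"
  using hopf lin_fun_sw[OF assms, of "\<lambda>x y. sc (eps x) y" a] lin_fun_sw[OF assms, of "\<lambda>x y. sc (eps y) x" a]
  by (simp_all add: hopf_algebra_def lin_funD[OF assms])

lemma sw_antipode:
  assumes "lin_fun sc f"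
  shows "sw a (\<lambda>x y. f (S x * y)) = eps a * f 1" "sw a (\<lambda>x y. f (x * S y)) = eps a * f 1"
  using hopf lin_fun_sw[OF assms, of "\<lambda>x y. S x * y" a] lin_fun_sw[OF assms, of "\<lambda>x y. x * S y" a]
  by (simp_all add: hopf_algebra_def lin_funD[OF assms])

section \<open>The antipode and its inverse\<close>

lemma S_one: "S 1 = 1"
proof (rule eq_if_lin_fun_eq)
  fix f assume f: "lin_fun sc f"
  have "bilin_form sc (\<lambda>x y. f (S x * y))"
    using f by (simp add: linearity)
  then show "f (S 1) = f 1"
    using sw_antipode(1)[OF f, of 1] by (simp add: sw_one eps_one)
qed

text \<open>Both sides equal \<open>S(x\<^sub>1 y\<^sub>1) x\<^sub>2 y\<^sub>2 S(y\<^sub>3) S(x\<^sub>3)\<close>.\<close>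

lemma S_mult: "S (x * y) = S y * S x"
proof (rule eq_if_lin_fun_eq)
  fix f assume f: "lin_fun sc f"
  define F where "F x1 x2 x3 y1 y2 y3 = f (S (x1 * y1) * (x2 * y2) * (S y3 * S x3))"
    for x1 x2 x3 y1 y2 y3
  have F_y: "trilin_form sc (\<lambda>y1 y2 y3. F x1 x2 x3 y1 y2 y3)" for x1 x2 x3
    using f by (simp add: F_def linearity)
  have "sw y (\<lambda>y1 y'. sw y' (\<lambda>y2 y3. F x1 x2 x3 y1 y2 y3)) = f (S (x1 * y) * (x2 * S x3))" for x1 x2 x3
  proof -
    have "sw y' (\<lambda>y2 y3. F x1 x2 x3 y1 y2 y3) = eps y' * f (S (x1 * y1) * (x2 * S x3))" for y1 y'
      using sw_antipode(2)[of "\<lambda>z. f (S (x1 * y1) * (x2 * z * S x3))" y'] f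
      by (simp add: F_def linearity)
    then show ?thesis
      using sw_counit(2)[of "\<lambda>y1. f (S (x1 * y1) * (x2 * S x3))" y] f
      by (simp add: linearity)
  qed
  moreover have "sw x' (\<lambda>x2 x3. f (S (x1 * y) * (x2 * S x3))) = eps x' * f (S (x1 * y))" for x1 x'
    using sw_antipode(2)[of "\<lambda>z. f (S (x1 * y) * z)" x'] f
    by (simp add: linearity)
  moreover have "sw x (\<lambda>x1 x'. eps x' * f (S (x1 * y))) = f (S (x * y))"
    using sw_counit(2)[of "\<lambda>x1. f (S (x1 * y))" x] f
    by (simp add: linearity)
  ultimately have "f (S (x * y))
      = sw x (\<lambda>x1 x'. sw x' (\<lambda>x2 x3. sw y (\<lambda>y1 y'. sw y' (\<lambda>y2 y3. F x1 x2 x3 y1 y2 y3))))"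
    by simp
  also have "\<dots> = sw x (\<lambda>x' x3. sw x' (\<lambda>x1 x2. sw y (\<lambda>y1 y'. sw y' (\<lambda>y2 y3. F x1 x2 x3 y1 y2 y3))))"
    using f by (intro sw_coassoc[symmetric]) (simp add: F_def linearity)
  also have "\<dots> = sw x (\<lambda>x' x3. sw x' (\<lambda>x1 x2. sw y (\<lambda>y' y3. sw y' (\<lambda>y1 y2. F x1 x2 x3 y1 y2 y3))))"
    by (simp add: sw_coassoc[OF F_y])
  also have "\<dots> = sw x (\<lambda>x' x3. sw y (\<lambda>y' y3. sw x' (\<lambda>x1 x2. sw y' (\<lambda>y1 y2. F x1 x2 x3 y1 y2 y3))))"
    by (subst (2) sw_swap) simp
  also have "\<dots> = sw x (\<lambda>x' x3. sw y (\<lambda>y' y3. eps x' * (eps y' * f (S y3 * S x3))))"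
  proof -
    have "sw x' (\<lambda>x1 x2. sw y' (\<lambda>y1 y2. F x1 x2 x3 y1 y2 y3)) = eps x' * (eps y' * f (S y3 * S x3))"
      for x' y' x3 y3
    proof -
      \<comment> \<open>The four inner legs are those of \<Delta>(x' y'), so the left antipode axiom
        for the product \<open>x' * y'\<close> applies.\<close>
      have "sw x' (\<lambda>x1 x2. sw y' (\<lambda>y1 y2. F x1 x2 x3 y1 y2 y3))
          = sw (x' * y') (\<lambda>u v. f (S u * v * (S y3 * S x3)))"
        using f by (subst sw_mult) (simp_all add: F_def linearity)
      also have "\<dots> = eps x' * (eps y' * f (S y3 * S x3))"
        using sw_antipode(1)[of "\<lambda>z. f (z * (S y3 * S x3))" "x' * y'"] f
        by (simp add: linearity eps_mult)
      finally show ?thesis .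
    qed
    then show ?thesis by simp
  qed
  also have "\<dots> = f (S y * S x)"
    using sw_counit(1)[of "\<lambda>z. f (S z * S w)" y for w] sw_counit(1)[of "\<lambda>z. f (S y * S z)" x] f
    by (simp add: sw_fun_mult) (simp add: linearity)
  finally show "f (S (x * y)) = f (S y * S x)" .
qed

lemma inv_S_lin: "inv S (x + y) = inv S x + inv S y" "inv S (sc c x) = sc c (inv S x)"
  using bij_S by (auto intro!: inv_f_eq simp: bij_is_inj S_lin surj_f_inv_f bij_is_surj)

text \<open>\<open>inv S\<close> is an antipode for the opposite multiplication: by
  anti-multiplicativity \<open>y * inv S x = inv S (x * S y)\<close>, so this is the right antipode
  axiom under \<open>inv S\<close>.\<close>

lemma sw_inv_antipode:
  assumes f: "lin_fun sc f"
  shows "sw a (\<lambda>x y. f (y * inv S x)) = eps a * f 1"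
proof -
  have "y * inv S x = inv S (x * S y)" for x y
    using bij_S by (intro inv_f_eq[symmetric]) (simp_all add: bij_is_inj S_mult surj_f_inv_f bij_is_surj)
  moreover have "inv S 1 = 1"
    using bij_S S_one by (intro inv_f_eq) (simp_all add: bij_is_inj)
  ultimately show ?thesis
    using sw_antipode(2)[of "\<lambda>z. f (inv S z)" a] f
    by (simp add: lin_fun_def inv_S_lin)
qed

end

section \<open>Slices of the comultiplication and cointegrals\<close>

context hopf
begin

section \<open>Group-like elements\<close>

lemma group_like_sw: "group_like sc Delta g \<Longrightarrow> bilin_form sc B \<Longrightarrow> sw g B = B g g"
  by (simp add: group_like_def tensor_eq_def sw_def)

text \<open>The counit axiom at \<open>g\<close> reads \<open>eps(g) g = g\<close>; a functional
  with value 1 at \<open>g\<close> extracts the scalar.\<close>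

lemma group_like_eps:
  assumes "group_like sc Delta g"
  shows "eps g = 1"
proof -
  obtain f where f: "lin_fun sc f" "f g = 1"
    using lin_fun_exists[of g] assms by (auto simp: group_like_def)
  have "bilin_form sc (\<lambda>x y. eps x * f y)"
    using f by (simp add: linearity)
  then show ?thesis
    using sw_counit(1)[OF f(1), of g] group_like_sw[OF assms] f(2) by simp
qed

lemma group_like_mult_S:
  assumes "group_like sc Delta g"
  shows "g * S g = 1"
proof (rule eq_if_lin_fun_eq)
  fix f assume f: "lin_fun sc f"
  have "bilin_form sc (\<lambda>x y. f (x * S y))"
    using f by (simp add: linearity)
  then show "f (g * S g) = f 1"
    using sw_antipode(2)[OF f, of g] group_like_sw[OF assms] group_like_eps[OF assms] by simp
qed

section \<open>Slices and cointegrals tested by functionals\<close>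

lemma V_right_iff:
  "v \<in> V_right sc Delta a \<longleftrightarrow>
    (\<exists>mu. lin_fun sc mu \<and> (\<forall>f. lin_fun sc f \<longrightarrow> f v = sw a (\<lambda>x y. mu x * f y)))"
proof -
  have "v = sum_list (map (\<lambda>(x, y). sc (mu x) y) (Delta a)) \<longleftrightarrow>
      (\<forall>f. lin_fun sc f \<longrightarrow> f v = sw a (\<lambda>x y. mu x * f y))" for mu
    using eq_if_lin_fun_eq[of v "sum_list (map (\<lambda>(x, y). sc (mu x) y) (Delta a))"]
    by (auto simp: lin_fun_sw lin_funD(2))
  then show ?thesis by (auto simp: V_right_def)
qed

lemma V_left_iff:
  "w \<in> V_left sc Delta a \<longleftrightarrow>
    (\<exists>nu. lin_fun sc nu \<and> (\<forall>f. lin_fun sc f \<longrightarrow> f w = sw a (\<lambda>x y. f x * nu y)))"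
proof -
  have "w = sum_list (map (\<lambda>(x, y). sc (nu y) x) (Delta a)) \<longleftrightarrow>
      (\<forall>f. lin_fun sc f \<longrightarrow> f w = sw a (\<lambda>x y. f x * nu y))" for nu
    using eq_if_lin_fun_eq[of w "sum_list (map (\<lambda>(x, y). sc (nu y) x) (Delta a))"]
    by (auto simp: lin_fun_sw lin_funD(2) mult.commute)
  then show ?thesis by (auto simp: V_left_def)
qed

lemma cointegrals_iff:
  "phi \<in> cointegrals sc Delta g X \<longleftrightarrow> phi \<in> dual_sub sc X \<and>
    (\<forall>psi. lin_fun sc psi \<and> (\<forall>x\<in>X. psi x = phi x) \<longrightarrow>
      (\<forall>a\<in>X. \<forall>f. lin_fun sc f \<longrightarrow> sw a (\<lambda>x y. f x * psi y) = phi a * f g))"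
proof -
  have "sum_list (map (\<lambda>(x, y). sc (psi y) x) (Delta a)) = sc c g \<longleftrightarrow>
      (\<forall>f. lin_fun sc f \<longrightarrow> sw a (\<lambda>x y. f x * psi y) = c * f g)" for psi :: "'h \<Rightarrow> 'k" and a c
    using eq_if_lin_fun_eq[of "sum_list (map (\<lambda>(x, y). sc (psi y) x) (Delta a))" "sc c g"]
      lin_fun_sw[of _ "\<lambda>x y. sc (psi y) x" a]
    by (auto simp: lin_funD(2) mult.commute)
  then show ?thesis by (simp add: cointegrals_def)
qed

lemma cointegral_extend:
  assumes "phi \<in> cointegrals sc Delta g X" "subspace X"
  obtains psi where "lin_fun sc psi" "\<And>x. x \<in> X \<Longrightarrow> psi x = phi x"
    "\<And>a f. a \<in> X \<Longrightarrow> lin_fun sc f \<Longrightarrow> sw a (\<lambda>x y. f x * psi y) = phi a * f g"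
proof -
  have "phi \<in> dual_sub sc X" using assms(1) by (simp add: cointegrals_iff)
  then obtain psi where "lin_fun sc psi" "\<And>x. x \<in> X \<Longrightarrow> psi x = phi x"
    using lin_fun_extend_subspace[OF assms(2), of phi] by (auto simp: dual_sub_def)
  then show thesis using assms(1) that by (auto simp: cointegrals_iff)
qed

lemma subspace_V_right: "subspace (V_right sc Delta a)"
proof (rule subspaceI; unfold V_right_iff; (elim exE conjE)?)
  show "\<exists>mu. lin_fun sc mu \<and> (\<forall>f. lin_fun sc f \<longrightarrow> f 0 = sw a (\<lambda>x y. mu x * f y))"
    using sw_fun_mult[of a 0 "\<lambda>_ _. 0"]
    by (intro exI[of _ "\<lambda>_. 0"]) (auto simp: lin_fun_zero lin_fun_def)
next
  fix x y mu nu assume "lin_fun sc mu" "lin_fun sc nu"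
    "\<forall>f. lin_fun sc f \<longrightarrow> f x = sw a (\<lambda>x y. mu x * f y)"
    "\<forall>f. lin_fun sc f \<longrightarrow> f y = sw a (\<lambda>x y. nu x * f y)"
  then show "\<exists>mu. lin_fun sc mu \<and> (\<forall>f. lin_fun sc f \<longrightarrow> f (x + y) = sw a (\<lambda>x y. mu x * f y))"
    by (intro exI[of _ "\<lambda>z. mu z + nu z"])
      (auto simp: lin_fun_def distrib_right sw_fun_add algebra_simps)
next
  fix c x mu assume "lin_fun sc mu" "\<forall>f. lin_fun sc f \<longrightarrow> f x = sw a (\<lambda>x y. mu x * f y)"
  then show "\<exists>mu. lin_fun sc mu \<and> (\<forall>f. lin_fun sc f \<longrightarrow> f (sc c x) = sw a (\<lambda>x y. mu x * f y))"
    by (intro exI[of _ "\<lambda>z. c * mu z"])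
      (auto simp: lin_fun_def mult.assoc sw_fun_mult mult.left_commute distrib_left)
qed

text \<open>Every slice is a combination of the second legs of the list \<open>Delta a\<close>,
  which is finite.\<close>

lemma V_right_finite_basis:
  obtains E where "finite E" "independent E" "span E = V_right sc Delta a"
proof -
  let ?V = "V_right sc Delta a"
  obtain E where E: "E \<subseteq> ?V" "independent E" "?V \<subseteq> span E"
    using maximal_independent_subset by blast
  have "sum_list (map (\<lambda>(x, y). sc (mu x) y) ps) \<in> span (snd ` set ps)" for mu :: "'h \<Rightarrow> 'k" and ps
  proof (induction ps)
    case (Cons p ps)
    have "snd ` set ps \<subseteq> snd ` set (p # ps)" by auto
    then have "span (snd ` set ps) \<subseteq> span (snd ` set (p # ps))" by (rule span_mono)
    then show ?case
      using Cons span_scale[OF span_base[of "snd p" "snd ` set (p # ps)"]]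
      by (auto simp: case_prod_unfold intro!: span_add)
  qed (simp add: span_0)
  then have "E \<subseteq> span (snd ` set (Delta a))" using E(1) by (auto simp: V_right_def)
  then have "finite E" using independent_span_bound E(2) by blast
  moreover have "span E = ?V" using E subspace_V_right span_subspace by blast
  ultimately show thesis using E(2) that by blast
qed

text \<open>Slicing by the counit returns \<open>a\<close>.\<close>

lemma self_in_V_right: "a \<in> V_right sc Delta a"
  using eps_lin_fun sw_counit(1)[of _ a] by (auto simp: V_right_iff)

text \<open>By coassociativity \<Delta>(v) can be computed by splitting the first leg of \<Delta>(a)
  instead of the second. The second leg stays intact, ready to be multiplied by an integral or
  paired with a functional.\<close>

lemma sw_V_right:
  assumes mu: "lin_fun sc mu" and v: "\<And>f. lin_fun sc f \<Longrightarrow> f v = sw a (\<lambda>x y. mu x * f y)"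
    and B: "bilin_form sc B"
  shows "sw v B = sw a (\<lambda>x y. sw x (\<lambda>u w. mu u * B w y))"
proof -
  have "sw v B = sw a (\<lambda>x y. mu x * sw y B)"
    using B by (intro v[of "\<lambda>v. sw v B"]) (simp add: lin_fun_def sw_add sw_scale)
  also have "\<dots> = sw a (\<lambda>x y. sw y (\<lambda>u w. mu x * B u w))"
    by (simp add: sw_fun_mult)
  also have "\<dots> = sw a (\<lambda>x y. sw x (\<lambda>u w. mu u * B w y))"
    using mu B by (intro sw_coassoc[symmetric]) (simp add: linearity)
  finally show ?thesis .
qed

text \<open>Slicing in the other order: \<open>phi(v) = mu((id \<otimes> phi) \<Delta>(a))\<close>,
  and the inner slice is \<open>phi(a) g\<close>. So a cointegral is determined by its value at
  \<open>a\<close>.\<close>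

lemma cointegral_eq_slice:
  assumes "phi \<in> cointegrals sc Delta g (V_right sc Delta a)"
    and "lin_fun sc mu" "\<And>f. lin_fun sc f \<Longrightarrow> f v = sw a (\<lambda>x y. mu x * f y)"
  shows "phi v = phi a * mu g"
proof -
  obtain psi where psi: "lin_fun sc psi" "\<And>x. x \<in> V_right sc Delta a \<Longrightarrow> psi x = phi x"
    "\<And>b f. b \<in> V_right sc Delta a \<Longrightarrow> lin_fun sc f \<Longrightarrow> sw b (\<lambda>x y. f x * psi y) = phi b * f g"
    using cointegral_extend[OF assms(1) subspace_V_right] by blast
  have "v \<in> V_right sc Delta a" using assms(2,3) by (auto simp: V_right_iff)
  then have "phi v = sw a (\<lambda>x y. mu x * psi y)"
    using psi(2) assms(3)[OF psi(1)] by simp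
  then show ?thesis
    using psi(3)[OF self_in_V_right assms(2)] by simp
qed

text \<open>The cointegral identity at \<open>a\<close> makes \<open>phi(a) g\<close> a left slice
  of \<open>a\<close>; divide by \<open>phi(a)\<close>. The coideal \<open>X\<close> is left open
  because both \<open>V_right\<close> and \<open>A_alg\<close> are needed.\<close>

lemma group_like_in_V_left_if_cointegral:
  assumes phi: "phi \<in> cointegrals sc Delta g X" "phi a \<noteq> 0" and X: "subspace X" "a \<in> X"
  shows "g \<in> V_left sc Delta a"
proof -
  obtain psi where psi: "lin_fun sc psi" "\<And>x. x \<in> X \<Longrightarrow> psi x = phi x"
    "\<And>b f. b \<in> X \<Longrightarrow> lin_fun sc f \<Longrightarrow> sw b (\<lambda>x y. f x * psi y) = phi b * f g"
    using cointegral_extend[OF phi(1) X(1)] by blast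
  have "lin_fun sc (\<lambda>x. inverse (phi a) * psi x)"
    using psi(1) by (simp add: lin_fun_def distrib_left)
  moreover have "f g = sw a (\<lambda>x y. f x * (inverse (phi a) * psi y))" if "lin_fun sc f" for f
  proof -
    have "sw a (\<lambda>x y. f x * (inverse (phi a) * psi y)) = inverse (phi a) * sw a (\<lambda>x y. f x * psi y)"
      by (subst sw_fun_mult[symmetric]) (simp add: mult.left_commute)
    then show ?thesis using psi(3)[OF X(2) that] phi(2) by simp
  qed
  ultimately show ?thesis by (auto simp: V_left_iff)
qed

lemma cointegral_zero_if_vanishes:
  assumes "phi \<in> cointegrals sc Delta g (V_right sc Delta a)" "phi a = 0"
  shows "phi = (\<lambda>_. 0)"
proof
  fix v
  show "phi v = 0"
  proof (cases "v \<in> V_right sc Delta a")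
    case True
    then obtain mu where "lin_fun sc mu" "\<And>f. lin_fun sc f \<Longrightarrow> f v = sw a (\<lambda>x y. mu x * f y)"
      by (auto simp: V_right_iff)
    from cointegral_eq_slice[OF assms(1) this] show ?thesis using assms(2) by simp
  next
    case False
    then show ?thesis using assms(1) by (simp add: cointegrals_iff dual_sub_def)
  qed
qed

text \<open>This is \<open>\<Delta>(V) \<subseteq> H \<otimes> V\<close>: slicing \<open>v = (mu \<otimes> id) \<Delta>(a)\<close> by \<open>f\<close> amounts to slicing \<open>a\<close> by the
  convolution of \<open>mu\<close> and \<open>f\<close>.\<close>

lemma sw_V_right_cong:
  assumes v: "v \<in> V_right sc Delta a"
    and f: "lin_fun sc f" and psi: "lin_fun sc psi" "lin_fun sc nu"
    and eq: "\<And>x. x \<in> V_right sc Delta a \<Longrightarrow> psi x = nu x"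
  shows "sw v (\<lambda>x y. f x * psi y) = sw v (\<lambda>x y. f x * nu y)"
proof -
  obtain mu where mu: "lin_fun sc mu" "\<And>f. lin_fun sc f \<Longrightarrow> f v = sw a (\<lambda>x y. mu x * f y)"
    using v by (auto simp: V_right_iff)
  define conv where "conv = (\<lambda>x. sw x (\<lambda>u w. mu u * f w))"
  have conv: "lin_fun sc conv" unfolding conv_def using mu(1) f by (simp add: linearity)
  have slice: "sw v (\<lambda>x y. f x * h y) = sw a (\<lambda>x y. conv x * h y)" if "lin_fun sc h" for h
  proof -
    have "sw v (\<lambda>x y. f x * h y) = sw a (\<lambda>x y. sw x (\<lambda>u w. mu u * (f w * h y)))"
      using that f by (intro sw_V_right[OF mu]) (simp_all add: linearity)
    then show ?thesis
      by (simp add: conv_def mult.assoc[symmetric] sw_fun_mult_right)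
  qed
  define z where "z = sum_list (map (\<lambda>(x, y). sc (conv x) y) (Delta a))"
  have z: "h z = sw a (\<lambda>x y. conv x * h y)" if "lin_fun sc h" for h
    using that by (simp add: z_def lin_fun_sw lin_funD(2))
  then have "z \<in> V_right sc Delta a" using conv by (auto simp: V_right_iff)
  then have "psi z = nu z" by (rule eq)
  then show ?thesis using z[OF psi(1)] z[OF psi(2)] slice[OF psi(1)] slice[OF psi(2)] by simp
qed

section \<open>Cointegrals from group-like slices and the dimension formula\<close>

text \<open>For \<open>v = (mu \<otimes> id) \<Delta>(a)\<close>, coassociativity gives \<open>(id
  \<otimes> nu) \<Delta>(v) = (mu \<otimes> id) \<Delta>(g) = mu(g) g\<close>, and
  \<open>mu(g) = nu(v)\<close>.\<close>

lemma cointegral_of_slice: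
  assumes g: "group_like sc Delta g"
    and nu: "lin_fun sc nu" "\<And>f. lin_fun sc f \<Longrightarrow> f g = sw a (\<lambda>x y. f x * nu y)"
  shows "(\<lambda>x. if x \<in> V_right sc Delta a then nu x else 0) \<in> cointegrals sc Delta g (V_right sc Delta a)"
    (is "?phi \<in> _")
  unfolding cointegrals_iff
proof (intro conjI allI impI ballI)
  show "?phi \<in> dual_sub sc (V_right sc Delta a)"
    using subspace_V_right[of a]
    by (auto simp: dual_sub_def lin_funD[OF nu(1)] subspace_add subspace_scale)
next
  fix psi v f
  assume psi: "lin_fun sc psi \<and> (\<forall>x\<in>V_right sc Delta a. psi x = ?phi x)"
    and v: "v \<in> V_right sc Delta a" and f: "lin_fun sc f"
  obtain mu where mu: "lin_fun sc mu" "\<And>f. lin_fun sc f \<Longrightarrow> f v = sw a (\<lambda>x y. mu x * f y)"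
    using v by (auto simp: V_right_iff)
  have bil: "bilin_form sc (\<lambda>x y. mu x * f y)" using mu(1) f by (simp add: linearity)
  \<comment> \<open>The arbitrary extension \<open>psi\<close> is traded for \<open>nu\<close>,
    which agrees with it on the second legs of \<Delta>(v).\<close>
  have "sw v (\<lambda>x y. f x * psi y) = sw v (\<lambda>x y. f x * nu y)"
    using psi by (intro sw_V_right_cong[OF v f _ nu(1)]) auto
  also have "\<dots> = sw a (\<lambda>x y. sw x (\<lambda>u w. mu u * (f w * nu y)))"
    using nu(1) f by (intro sw_V_right[OF mu]) (simp_all add: linearity)
  also have "\<dots> = sw a (\<lambda>x y. sw x (\<lambda>u w. mu u * f w) * nu y)"
    by (simp add: mult.assoc[symmetric] sw_fun_mult_right)
  also have "\<dots> = sw g (\<lambda>u w. mu u * f w)"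
    using bil by (intro nu(2)[symmetric]) (simp add: lin_fun_def sw_add sw_scale)
  also have "\<dots> = mu g * f g" using group_like_sw[OF g bil] .
  \<comment> \<open>Both equal \<open>(mu \<otimes> nu) \<Delta>(a)\<close>.\<close>
  also have "mu g = nu v" using mu(2)[OF nu(1)] nu(2)[OF mu(1)] by simp
  finally show "sw v (\<lambda>x y. f x * psi y) = ?phi v * f g" using v by simp
qed

text \<open>Uniqueness up to a scalar: if \<open>v\<close> is the slice of \<open>a\<close> by
  \<open>mu\<close>, then \<open>phi v = phi a * mu g\<close> and
  \<open>mu g = nu v\<close>.\<close>

lemma cointegral_eq_scaled_slice:
  assumes phi: "phi \<in> cointegrals sc Delta g (V_right sc Delta a)"
    and nu: "lin_fun sc nu" "\<And>f. lin_fun sc f \<Longrightarrow> f g = sw a (\<lambda>x y. f x * nu y)"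
    and v: "v \<in> V_right sc Delta a"
  shows "phi v = phi a * nu v"
proof -
  obtain mu where mu: "lin_fun sc mu" "\<And>f. lin_fun sc f \<Longrightarrow> f v = sw a (\<lambda>x y. mu x * f y)"
    using v by (auto simp: V_right_iff)
  then show ?thesis
    using cointegral_eq_slice[OF phi mu] mu(2)[OF nu(1)] nu(2)[OF mu(1)] by simp
qed

text \<open>An extension of the zero functional may be non-zero off the coideal, so this rests on
  \<Delta>(V) lying in \<open>H \<otimes> V\<close>.\<close>

lemma zero_in_cointegrals: "(\<lambda>_. 0) \<in> cointegrals sc Delta g (V_right sc Delta a)"
proof -
  have "sw v (\<lambda>x y. f x * psi y) = 0"
    if "lin_fun sc psi" "\<forall>x\<in>V_right sc Delta a. psi x = 0" "v \<in> V_right sc Delta a" "lin_fun sc f"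
    for psi v and f :: "'h \<Rightarrow> 'k"
    using sw_V_right_cong[OF that(3,4,1), of "\<lambda>_. 0"] that(2) sw_fun_mult[of v 0 "\<lambda>_ _. 0"]
    by (simp add: lin_fun_def)
  then show ?thesis by (auto simp: cointegrals_iff dual_sub_def)
qed

lemma vector_space_fscale: "vector_space (fscale :: 'k \<Rightarrow> ('h \<Rightarrow> 'k) \<Rightarrow> 'h \<Rightarrow> 'k)"
  by unfold_locales (auto simp: fscale_def algebra_simps)

lemma dim_cointegrals:
  assumes g: "group_like sc Delta g" "g \<in> V_left sc Delta a"
  shows "vector_space.dim fscale (cointegrals sc Delta g (V_right sc Delta a)) = 1"
proof -
  interpret fs: vector_space "fscale :: 'k \<Rightarrow> ('h \<Rightarrow> 'k) \<Rightarrow> 'h \<Rightarrow> 'k"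
    by (rule vector_space_fscale)
  obtain nu where nu: "lin_fun sc nu" "\<And>f. lin_fun sc f \<Longrightarrow> f g = sw a (\<lambda>x y. f x * nu y)"
    using g(2) by (auto simp: V_left_iff)
  define phi0 where "phi0 = (\<lambda>x. if x \<in> V_right sc Delta a then nu x else 0)"
  \<comment> \<open>Apply the counit to \<open>g = (id \<otimes> nu) \<Delta>(a)\<close>:
    \<open>nu a = eps g = 1\<close>. Hence \<open>phi0\<close> is non-zero and \<open>phi a\<close>
    is the coefficient of \<open>phi\<close>.\<close>
  have "phi0 a = 1"
    using nu(2)[OF eps_lin_fun] sw_counit(1)[OF nu(1), of a] group_like_eps[OF g(1)] self_in_V_right[of a]
    by (simp add: phi0_def)
  have "phi = fscale (phi a) phi0" if "phi \<in> cointegrals sc Delta g (V_right sc Delta a)" for phi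
    using cointegral_eq_scaled_slice[OF that nu] that
    by (auto simp: fscale_def phi0_def fun_eq_iff cointegrals_iff dual_sub_def)
  then have "cointegrals sc Delta g (V_right sc Delta a) \<subseteq> fs.span {phi0}"
    by (auto simp: fs.span_singleton)
  moreover have "phi0 \<in> cointegrals sc Delta g (V_right sc Delta a)"
    unfolding phi0_def using cointegral_of_slice[OF g(1) nu] .
  moreover have "phi0 \<noteq> 0" using \<open>phi0 a = 1\<close> by auto
  ultimately show ?thesis by (intro fs.dim_unique[of "{phi0}"]) simp_all
qed

end

section \<open>Elements of relative integral type\<close>

locale rel_integral = hopf sc Delta eps S
  for sc :: "'k::field \<Rightarrow> 'h::ring_1 \<Rightarrow> 'h" and Delta eps S +
  fixes Lam L :: 'h
  assumes rel_integral: "rel_integral_type sc Delta Lam L"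
begin

section \<open>The algebra \<open>A\<close> and its witnesses\<close>

abbreviation "V \<equiv> V_right sc Delta L"
abbreviation "A \<equiv> A_alg sc Delta L"

text \<open>The membership condition of \<open>A\<close> with its witness \<open>b\<close> kept
  explicit, since \<open>eps b\<close> and \<open>S b\<close> govern how \<open>a\<close> acts on
  \<open>L\<close> and on \<open>V\<close>.\<close>

definition absorbs :: "'h \<Rightarrow> 'h \<Rightarrow> bool" where
  "absorbs a b \<longleftrightarrow> (\<forall>B. bilin_form sc B \<longrightarrow> sw a (\<lambda>x y. B x (y * L)) = B b L)"

lemma absorbsI: "(\<And>B. bilin_form sc B \<Longrightarrow> sw a (\<lambda>x y. B x (y * L)) = B b L) \<Longrightarrow> absorbs a b"
  by (simp add: absorbs_def)

lemma absorbsD: "absorbs a b \<Longrightarrow> bilin_form sc B \<Longrightarrow> sw a (\<lambda>x y. B x (y * L)) = B b L"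
  by (simp add: absorbs_def)

lemma tensor_eq_mult_1_iff:
  "tensor_eq sc (mult_1_tensor (Delta a) L) [(b, L)] \<longleftrightarrow> absorbs a b"
  by (simp add: tensor_eq_def mult_1_tensor_def absorbs_def sw_def comp_def case_prod_unfold)

lemma A_iff: "a \<in> A \<longleftrightarrow> (\<exists>b. absorbs a b)"
  by (simp add: A_alg_def tensor_eq_mult_1_iff)

lemma L_nonzero: "L \<noteq> 0" and absorbs_L: "absorbs L Lam"
  using rel_integral by (simp_all add: rel_integral_type_def tensor_eq_mult_1_iff)

lemma one_in_A: "1 \<in> A"
  unfolding A_iff
proof (intro exI absorbsI)
  fix B :: "'h \<Rightarrow> 'h \<Rightarrow> 'k" assume "bilin_form sc B"
  then have "bilin_form sc (\<lambda>x y. B x (y * L))" by (simp add: linearity)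
  then show "sw 1 (\<lambda>x y. B x (y * L)) = B 1 L" by (simp add: sw_one)
qed

lemma subspace_A: "subspace A"
proof (rule subspaceI; unfold A_iff; (elim exE)?)
  have lin: "lin_fun sc (\<lambda>a. sw a (\<lambda>x y. B x (y * L)))" if "bilin_form sc B" for B
    using that by (simp add: linearity)
  have lin': "lin_fun sc (\<lambda>b. B b L)" if "bilin_form sc B" for B
    using that by (simp add: bilin_form_def)
  note zero = lin_fun_zero[OF lin] lin_fun_zero[OF lin']
  note rules = lin_funD[OF lin] lin_funD[OF lin']
  show "\<exists>b. absorbs 0 b"
    by (rule exI[of _ 0], rule absorbsI) (simp add: zero)
  show "\<exists>b. absorbs (x + y) b" if "absorbs x b" "absorbs y c" for x y b c
    by (rule exI[of _ "b + c"], rule absorbsI) (simp add: rules absorbsD[OF that(1)] absorbsD[OF that(2)])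
  show "\<exists>b. absorbs (sc c x) b" if "absorbs x b" for x b c
    by (rule exI[of _ "sc c b"], rule absorbsI) (simp add: rules absorbsD[OF that])
qed

text \<open>Witnesses multiply: \<Delta>(a') absorbs first, leaving \<Delta>(a) applied to
  \<open>b' \<otimes> L\<close>, which becomes \<open>b b' \<otimes> L\<close>.\<close>

lemma A_mult_closed:
  assumes "a \<in> A" "a' \<in> A"
  shows "a * a' \<in> A"
proof -
  obtain b b' where b: "absorbs a b" "absorbs a' b'" using assms by (auto simp: A_iff)
  have "absorbs (a * a') (b * b')"
  proof (rule absorbsI)
    fix B :: "'h \<Rightarrow> 'h \<Rightarrow> 'k" assume B: "bilin_form sc B"
    have "sw (a * a') (\<lambda>x y. B x (y * L)) = sw a (\<lambda>x y. sw a' (\<lambda>u v. B (x * u) (y * v * L)))"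
      using B by (intro sw_mult) (simp add: linearity)
    also have "\<dots> = sw a' (\<lambda>u v. sw a (\<lambda>x y. B (x * u) (y * (v * L))))"
      by (subst sw_swap) (simp add: mult.assoc)
    also have "\<dots> = sw a (\<lambda>x y. B (x * b') (y * L))"
      using B by (intro absorbsD[OF b(2)]) (simp add: linearity)
    also have "\<dots> = B (b * b') L"
      using B by (intro absorbsD[OF b(1), of "\<lambda>x y. B (x * b') y"]) (simp add: linearity)
    finally show "sw (a * a') (\<lambda>x y. B x (y * L)) = B (b * b') L" .
  qed
  then show ?thesis by (auto simp: A_iff)
qed

text \<open>The witness for the slice of \<open>L\<close> by \<open>mu\<close> is the slice of
  \<open>Lam\<close> by \<open>mu\<close>: split the first leg in \<Delta>(L)(1 \<otimes> L) = Lam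
  \<otimes> L and apply \<open>mu\<close>.\<close>

lemma V_subset_A: "V \<subseteq> A"
proof
  fix v assume "v \<in> V"
  then obtain mu where mu: "lin_fun sc mu" "\<And>f. lin_fun sc f \<Longrightarrow> f v = sw L (\<lambda>x y. mu x * f y)"
    by (auto simp: V_right_iff)
  define b where "b = sum_list (map (\<lambda>(x, y). sc (mu x) y) (Delta Lam))"
  have b: "f b = sw Lam (\<lambda>x y. mu x * f y)" if "lin_fun sc f" for f
    using that by (simp add: b_def lin_fun_sw lin_funD(2))
  have "absorbs v b"
  proof (rule absorbsI)
    fix B :: "'h \<Rightarrow> 'h \<Rightarrow> 'k" assume B: "bilin_form sc B"
    have "sw v (\<lambda>x y. B x (y * L)) = sw L (\<lambda>x y. sw x (\<lambda>u w. mu u * B w (y * L)))"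
      using B by (intro sw_V_right[OF mu]) (simp_all add: linearity)
    also have "\<dots> = sw Lam (\<lambda>u w. mu u * B w L)"
      using B mu(1) by (intro absorbsD[OF absorbs_L]) (simp add: linearity)
    also have "\<dots> = B b L"
      using B by (intro b[symmetric]) (simp add: bilin_form_def)
    finally show "sw v (\<lambda>x y. B x (y * L)) = B b L" .
  qed
  then show "v \<in> A" by (auto simp: A_iff)
qed

text \<open>Apply \<open>eps \<otimes> id\<close> to the absorption identity.\<close>

lemma absorbs_mult_L: "absorbs a b \<Longrightarrow> a * L = sc (eps b) L"
proof (rule eq_if_lin_fun_eq)
  fix f assume ab: "absorbs a b" and f: "lin_fun sc f"
  have "f (a * L) = sw a (\<lambda>x y. eps x * f (y * L))"
    using f by (intro sw_counit(1)[of "\<lambda>y. f (y * L)", symmetric]) (simp add: linearity)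
  also have "\<dots> = eps b * f L"
    using f by (intro absorbsD[OF ab]) (simp add: linearity)
  finally show "f (a * L) = f (sc (eps b) L)" by (simp add: lin_funD[OF f])
qed

text \<open>\<open>(1 \<otimes> a) \<Delta>(L) = (S(a\<^sub>1) \<otimes> 1) \<Delta>(a\<^sub>2 L) = (S(b) \<otimes> 1) \<Delta>(L)\<close>.\<close>

lemma absorbs_shift:
  assumes ab: "absorbs a b" and B: "bilin_form sc B"
  shows "sw L (\<lambda>x y. B x (a * y)) = sw L (\<lambda>x y. B (S b * x) y)"
proof -
  have "sw L (\<lambda>x y. B (S b * x) y) = sw a (\<lambda>x y. sw (y * L) (\<lambda>u v. B (S x * u) v))"
    using B by (intro absorbsD[OF ab, symmetric]) (simp add: bilin_form_left_fun[OF B] linearity)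
  also have "\<dots> = sw a (\<lambda>x y. sw y (\<lambda>p q. sw L (\<lambda>u v. B (S x * (p * u)) (q * v))))"
    using B by (subst sw_mult) (simp_all add: linearity)
  also have "\<dots> = sw a (\<lambda>x y. sw x (\<lambda>p q. sw L (\<lambda>u v. B (S p * (q * u)) (y * v))))"
    using B by (intro sw_coassoc[symmetric]) (simp add: linearity)
  also have "\<dots> = sw a (\<lambda>x y. sw L (\<lambda>u v. eps x * B u (y * v)))"
  proof -
    have "sw x (\<lambda>p q. B (S p * (q * u)) (y * v)) = eps x * B u (y * v)" for x y u v
      using sw_antipode(1)[of "\<lambda>z. B (z * u) (y * v)" x] B by (simp add: linearity)
    then have "sw x (\<lambda>p q. sw L (\<lambda>u v. B (S p * (q * u)) (y * v))) = sw L (\<lambda>u v. eps x * B u (y * v))"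
      for x y by (subst sw_swap) simp
    then show ?thesis by simp
  qed
  also have "\<dots> = sw a (\<lambda>x y. eps x * sw L (\<lambda>u v. B u (y * v)))"
    by (simp add: sw_fun_mult)
  also have "\<dots> = sw L (\<lambda>u v. B u (a * v))"
    using B by (intro sw_counit(1)) (simp add: linearity)
  finally show ?thesis by simp
qed

section \<open>The action of \<open>A\<close> on \<open>V\<close>\<close>

text \<open>Left multiplication by \<open>a\<close> turns the slice of \<open>L\<close> by
  \<open>mu\<close> into the slice by \<open>x \<mapsto> mu(S(b) x)\<close>.\<close>

lemma A_mult_V:
  assumes "a \<in> A" "v \<in> V"
  shows "a * v \<in> V"
proof -
  obtain b where b: "absorbs a b" using assms by (auto simp: A_iff)
  obtain mu where mu: "lin_fun sc mu" "\<And>f. lin_fun sc f \<Longrightarrow> f v = sw L (\<lambda>x y. mu x * f y)"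
    using assms(2) by (auto simp: V_right_iff)
  have "f (a * v) = sw L (\<lambda>x y. mu (S b * x) * f y)" if f: "lin_fun sc f" for f
  proof -
    have "f (a * v) = sw L (\<lambda>x y. mu x * f (a * y))"
      using f by (intro mu(2)[of "\<lambda>v. f (a * v)"]) (simp add: linearity)
    also have "\<dots> = sw L (\<lambda>x y. mu (S b * x) * f y)"
      using f mu(1) by (intro absorbs_shift[OF b]) (simp add: linearity)
    finally show ?thesis .
  qed
  moreover have "lin_fun sc (\<lambda>x. mu (S b * x))" using mu(1) by (simp add: linearity)
  ultimately show ?thesis by (auto simp: V_right_iff)
qed

text \<open>Evaluate the hypothesis at \<open>nu(L\<^sub>1) f(a L\<^sub>3 S\<^sup>-\<^sup>1(L\<^sub>2)) = nu(L) f(a)\<close> with \<open>nu(L) = 1\<close>.\<close>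

lemma zero_if_annihilates_Delta_L:
  assumes "\<And>B. bilin_form sc B \<Longrightarrow> sw L (\<lambda>x y. B x (a * y)) = 0"
  shows "a = 0"
proof (rule eq_if_lin_fun_eq)
  fix f assume f: "lin_fun sc f"
  obtain nu where nu: "lin_fun sc nu" "nu L = 1" using lin_fun_exists[OF L_nonzero] .
  have "0 = sw L (\<lambda>x y. sw x (\<lambda>u v. nu u * f (a * y * inv S v)))"
    using f nu(1) by (intro assms[symmetric]) (simp add: linearity inv_S_lin)
  also have "\<dots> = sw L (\<lambda>x y. sw y (\<lambda>u v. nu x * f (a * v * inv S u)))"
    using f nu(1) by (intro sw_coassoc) (simp add: linearity inv_S_lin)
  also have "\<dots> = sw L (\<lambda>x y. eps y * (nu x * f a))"
  proof -
    have "sw y (\<lambda>u v. f (a * v * inv S u)) = eps y * f a" for y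
      using sw_inv_antipode[of "\<lambda>z. f (a * z)" y] f by (simp add: linearity)
    then show ?thesis by (simp add: sw_fun_mult mult.left_commute)
  qed
  also have "\<dots> = f a"
    using sw_counit(2)[of "\<lambda>x. nu x * f a" L] nu by (simp add: linearity)
  finally show "f a = f 0" by (simp add: lin_fun_zero[OF f])
qed

text \<open>The elements \<open>a * v\<close> are the slices of
  \<open>(1 \<otimes> a) \<Delta>(L)\<close>; if all vanish, rank-one forms show that this tensor is
  zero.\<close>

lemma zero_if_annihilates_V:
  assumes "\<And>v. v \<in> V \<Longrightarrow> a * v = 0"
  shows "a = 0"
proof (rule zero_if_annihilates_Delta_L)
  fix B :: "'h \<Rightarrow> 'h \<Rightarrow> 'k" assume B: "bilin_form sc B"
  have "tensor_eq sc (map (\<lambda>(x, y). (x, a * y)) (Delta L)) []"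
  proof (rule tensor_eq_Nil_if_products)
    fix mu f assume mu: "lin_fun sc mu" and f: "lin_fun sc f"
    define v where "v = sum_list (map (\<lambda>(x, y). sc (mu x) y) (Delta L))"
    have v: "h v = sw L (\<lambda>x y. mu x * h y)" if "lin_fun sc h" for h
      using that by (simp add: v_def lin_fun_sw lin_funD(2))
    then have "v \<in> V" using mu by (auto simp: V_right_iff)
    then have "a * v = 0" by (rule assms)
    moreover have "f (a * v) = sw L (\<lambda>x y. mu x * f (a * y))"
      using f by (intro v) (simp add: linearity)
    ultimately show "sum_list (map (\<lambda>(x, y). mu x * f y) (map (\<lambda>(x, y). (x, a * y)) (Delta L))) = 0"
      by (simp add: lin_fun_zero[OF f] sw_def comp_def case_prod_unfold)
  qed
  then show "sw L (\<lambda>x y. B x (a * y)) = 0"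
    using B by (simp add: tensor_eq_def sw_def comp_def case_prod_unfold)
qed

text \<open>The action on \<open>V\<close> is faithful, so the finitely many matrix entries
  \<open>h e' (a * e)\<close> separate the elements of \<open>A\<close>.\<close>

lemma A_finite_span: "\<exists>E. finite E \<and> A \<subseteq> span E"
proof -
  obtain E where E: "finite E" "independent E" "span E = V"
    using V_right_finite_basis by blast
  obtain h where h: "\<And>e. lin_fun sc (h e)"
    "\<And>v. v \<in> span E \<Longrightarrow> (\<And>e. e \<in> E \<Longrightarrow> h e v = 0) \<Longrightarrow> v = 0"
    using lin_funs_separate_finite_span[OF E(1,2)] by blast
  have "\<exists>F. finite F \<and> card F \<le> card (E \<times> E) \<and> A \<subseteq> span F"
  proof (rule finite_span_if_lin_funs_separate[where f="\<lambda>(e, e') a. h e' (a * e)"])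
    show "finite (E \<times> E)" using E(1) by simp
    show "subspace A" by (rule subspace_A)
    show "lin_fun sc ((\<lambda>(e, e') a. h e' (a * e)) i)" for i
      using h(1) by (cases i) (simp add: linearity)
    show "a = 0" if a: "a \<in> A" "\<And>i. i \<in> E \<times> E \<Longrightarrow> (\<lambda>(e, e') a. h e' (a * e)) i a = 0" for a
    proof (rule zero_if_annihilates_V)
      have zero: "a * e = 0" if "e \<in> E" for e
      proof (rule h(2))
        have "e \<in> V" using that E(3) span_base by blast
        then show "a * e \<in> span E" using A_mult_V[OF a(1)] E(3) by simp
        show "h e' (a * e) = 0" if "e' \<in> E" for e'
          using a(2)[of "(e, e')"] that \<open>e \<in> E\<close> by simp
      qed
      have "subspace {v. a * v = 0}" by (rule subspaceI) (simp_all add: linearity)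
      then show "a * v = 0" if "v \<in> V" for v
        using span_induct[of v E "\<lambda>v. a * v = 0"] that zero E(3) by simp
    qed
  qed
  then show ?thesis by blast
qed

section \<open>Equality of \<open>V\<close> and \<open>A\<close> for a group-like left slice\<close>

context
  fixes g nu
  assumes g: "group_like sc Delta g"
    and nu: "lin_fun sc nu" "\<And>f. lin_fun sc f \<Longrightarrow> f g = sw L (\<lambda>x y. f x * nu y)"
begin

text \<open>\<open>f(S(b) g) = f(S(b) L\<^sub>1) nu(L\<^sub>2) = f(L\<^sub>1) nu(a L\<^sub>2)\<close>, and \<open>g\<close> is invertible.\<close>

lemma zero_if_slice_vanishes:
  assumes a: "a \<in> A" and "\<And>v. v \<in> V \<Longrightarrow> nu (a * v) = 0"
  shows "a = 0"
proof -
  obtain b where b: "absorbs a b" using a by (auto simp: A_iff)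
  have "S b * g = 0"
  proof (rule eq_if_lin_fun_eq)
    fix f assume f: "lin_fun sc f"
    define v where "v = sum_list (map (\<lambda>(x, y). sc (f x) y) (Delta L))"
    have v: "h v = sw L (\<lambda>x y. f x * h y)" if "lin_fun sc h" for h
      using that by (simp add: v_def lin_fun_sw lin_funD(2))
    then have "v \<in> V" using f by (auto simp: V_right_iff)
    have "f (S b * g) = sw L (\<lambda>x y. f (S b * x) * nu y)"
      using f by (intro nu(2)[of "\<lambda>z. f (S b * z)"]) (simp add: linearity)
    also have "\<dots> = sw L (\<lambda>x y. f x * nu (a * y))"
      using f nu(1) by (intro absorbs_shift[OF b, symmetric]) (simp add: linearity)
    also have "\<dots> = nu (a * v)"
      using nu(1) by (intro v[symmetric]) (simp add: linearity)
    also have "\<dots> = 0" using assms(2) \<open>v \<in> V\<close> .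
    finally show "f (S b * g) = f 0" by (simp add: lin_fun_zero[OF f])
  qed
  then have "S b * (g * S g) = 0" by (simp add: mult.assoc[symmetric])
  then have "S b = 0" using group_like_mult_S[OF g] by simp
  show ?thesis
  proof (rule zero_if_annihilates_Delta_L)
    fix B :: "'h \<Rightarrow> 'h \<Rightarrow> 'k" assume B: "bilin_form sc B"
    have "sw L (\<lambda>x y. B x (a * y)) = sw L (\<lambda>x y. B 0 y)"
      using absorbs_shift[OF b B] \<open>S b = 0\<close> by simp
    also have "\<dots> = sw L (\<lambda>x y. 0)"
      using bilin_form_left_fun(2)[OF B, of 0 0] by simp
    also have "\<dots> = 0" using sw_fun_mult[of L 0 "\<lambda>_ _. 0"] by simp
    finally show "sw L (\<lambda>x y. B x (a * y)) = 0" .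
  qed
qed

text \<open>The functionals \<open>a \<mapsto> nu (a * e)\<close>, with \<open>e\<close> in a basis
  of \<open>V\<close>, separate \<open>A\<close>, so \<open>A\<close> has dimension at most that of
  \<open>V\<close>; an element of \<open>A\<close> outside \<open>V\<close> would exceed this
  bound.\<close>

lemma V_eq_A: "V = A"
proof (rule subset_antisym[OF V_subset_A], rule subsetI, rule ccontr)
  fix a0 assume a0: "a0 \<in> A" "a0 \<notin> V"
  obtain E where E: "finite E" "independent E" "span E = V"
    using V_right_finite_basis by blast
  have "\<exists>F. finite F \<and> card F \<le> card E \<and> A \<subseteq> span F"
  proof (rule finite_span_if_lin_funs_separate[where f="\<lambda>e a. nu (a * e)", OF E(1) subspace_A])
    show "lin_fun sc (\<lambda>a. nu (a * e))" for e
      using nu(1) by (simp add: linearity)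
    show "a = 0" if a: "a \<in> A" "\<And>e. e \<in> E \<Longrightarrow> nu (a * e) = 0" for a
    proof (rule zero_if_slice_vanishes[OF a(1)])
      have "subspace {v. nu (a * v) = 0}"
        using nu(1) lin_fun_zero[OF nu(1)] by (intro subspaceI) (simp_all add: linearity)
      then show "nu (a * v) = 0" if "v \<in> V" for v
        using span_induct[of v E "\<lambda>v. nu (a * v) = 0"] that a(2) E(3) by simp
    qed
  qed
  then obtain F where F: "finite F" "card F \<le> card E" "A \<subseteq> span F" by blast
  have "E \<subseteq> A" using E(3) V_subset_A span_base by blast
  then have "insert a0 E \<subseteq> span F" using F(3) a0(1) by blast
  moreover have "independent (insert a0 E)"
    using E a0(2) by (intro independent_insertI) auto
  ultimately have "card (insert a0 E) \<le> card F" using independent_span_bound[OF F(1)] by blast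
  moreover have "a0 \<notin> E" using a0(2) E(3) span_base by blast
  ultimately show False using F(2) E(1) by simp
qed

end

section \<open>Faithful cointegrals\<close>

text \<open>In a basis of \<open>A\<close> containing \<open>L\<close>, the pairing with
  \<open>L\<close> sends \<open>a\<close> to \<open>phi (a * L) = eps b * phi L\<close>. If
  \<open>phi L = 0\<close>, the other basis elements already separate \<open>A\<close> by
  faithfulness, one functional too few for the dimension.\<close>

lemma cointegral_nonzero_at_L:
  assumes phi: "phi \<in> cointegrals sc Delta g A" "faithful_on phi A"
  shows "phi L \<noteq> 0"
proof
  assume zero: "phi L = 0"
  obtain psi where psi: "lin_fun sc psi" "\<And>x. x \<in> A \<Longrightarrow> psi x = phi x"
    "\<And>b f. b \<in> A \<Longrightarrow> lin_fun sc f \<Longrightarrow> sw b (\<lambda>x y. f x * psi y) = phi b * f g"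
    using cointegral_extend[OF phi(1) subspace_A] by blast
  have L: "L \<in> A" using self_in_V_right V_subset_A by blast
  have "independent {L}" using L_nonzero by simp
  then obtain E where E: "{L} \<subseteq> E" "E \<subseteq> A" "independent E" "A \<subseteq> span E"
    using maximal_independent_subset_extend[of "{L}" A] L by blast
  have "finite E" using A_finite_span independent_span_bound E(2,3) by (meson order_trans)
  have "\<exists>F. finite F \<and> card F \<le> card (E - {L}) \<and> A \<subseteq> span F"
  proof (rule finite_span_if_lin_funs_separate[where f="\<lambda>e a. psi (a * e)", OF _ subspace_A])
    show "finite (E - {L})" using \<open>finite E\<close> by simp
    show "lin_fun sc (\<lambda>a. psi (a * e))" for e
      using psi(1) by (simp add: linearity)
    show "a = 0" if a: "a \<in> A" "\<And>e. e \<in> E - {L} \<Longrightarrow> psi (a * e) = 0" for a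
    proof -
      obtain b where "absorbs a b" using a(1) by (auto simp: A_iff)
      then have "psi (a * L) = 0"
        using zero psi(2)[OF L] by (simp add: absorbs_mult_L lin_funD[OF psi(1)])
      then have base: "psi (a * e) = 0" if "e \<in> E" for e
        using a(2) that by (cases "e = L") auto
      have "subspace {v. psi (a * v) = 0}"
        using psi(1) lin_fun_zero[OF psi(1)] by (intro subspaceI) (simp_all add: linearity)
      then have "psi (a * v) = 0" if "v \<in> A" for v
        using span_induct[of v E "\<lambda>v. psi (a * v) = 0"] that base E(4) by blast
      then have "phi (a * v) = 0" if "v \<in> A" for v
        using psi(2)[OF A_mult_closed[OF a(1) that]] that by simp
      then show ?thesis using phi(2) a(1) by (simp add: faithful_on_def)
    qed
  qed
  then obtain F where F: "finite F" "card F \<le> card (E - {L})" "A \<subseteq> span F" by blast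
  then have "card E \<le> card F" using independent_span_bound[OF F(1) E(3)] E(2) by blast
  moreover have "card (E - {L}) < card E"
    using \<open>finite E\<close> E(1) by (intro psubset_card_mono) auto
  ultimately show False using F(2) by simp
qed

lemma non_degenerate_if_group_like_in_V_left:
  assumes "group_like sc Delta g" "g \<in> V_left sc Delta L"
  shows "non_degenerate sc Delta L \<and> V = A"
proof -
  obtain nu where "lin_fun sc nu" "\<And>f. lin_fun sc f \<Longrightarrow> f g = sw L (\<lambda>x y. f x * nu y)"
    using assms(2) by (auto simp: V_left_iff)
  then have "V = A" by (rule V_eq_A[OF assms(1)])
  then show ?thesis using one_in_A by (simp add: non_degenerate_def)
qed

text \<open>On \<open>V\<close> the cointegral is \<open>phi L\<close> times the slice functional
  \<open>nu\<close>, with \<open>phi L\<close> non-zero. As \<open>a * v\<close> stays in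
  \<open>V\<close>, the annihilation property passes from \<open>phi\<close> to
  \<open>nu\<close>.\<close>

lemma faithful_cointegral:
  assumes g: "group_like sc Delta g" and phi: "phi \<in> cointegrals sc Delta g V" "phi \<noteq> (\<lambda>_. 0)"
  shows "faithful_on phi V"
  unfolding faithful_on_def
proof (intro ballI impI)
  fix a assume a: "a \<in> V" "\<forall>v\<in>V. phi (a * v) = 0"
  have "phi L \<noteq> 0" using phi cointegral_zero_if_vanishes by blast
  then have "g \<in> V_left sc Delta L"
    by (rule group_like_in_V_left_if_cointegral[OF phi(1) _ subspace_V_right self_in_V_right])
  then obtain nu where nu: "lin_fun sc nu" "\<And>f. lin_fun sc f \<Longrightarrow> f g = sw L (\<lambda>x y. f x * nu y)"
    by (auto simp: V_left_iff)
  have "a \<in> A" using a(1) V_subset_A by blast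
  show "a = 0"
  proof (rule zero_if_slice_vanishes[OF g nu \<open>a \<in> A\<close>])
    fix v assume "v \<in> V"
    then show "nu (a * v) = 0"
      using a(2) cointegral_eq_scaled_slice[OF phi(1) nu A_mult_V[OF \<open>a \<in> A\<close>]] \<open>phi L \<noteq> 0\<close> by auto
  qed
qed

end

theorem mainTheorem15:
  fixes sc :: "'k::field \<Rightarrow> 'h::ring_1 \<Rightarrow> 'h"
    and Delta :: "'h \<Rightarrow> ('h \<times> 'h) list" and eps :: "'h \<Rightarrow> 'k" and S :: "'h \<Rightarrow> 'h"
    and Lam Lt g :: 'h
  assumes "hopf_algebra sc Delta eps S"
    and "integral_type sc Delta Lam"
    and "rel_integral_type sc Delta Lam Lt"
    and "group_like sc Delta g"
  shows "(g \<in> V_left sc Delta Lt \<longrightarrow>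
            vector_space.dim fscale (cointegrals sc Delta g (V_right sc Delta Lt)) = 1)
       \<and> (g \<notin> V_left sc Delta Lt \<longrightarrow>
            cointegrals sc Delta g (V_right sc Delta Lt) = {\<lambda>_. 0})
       \<and> (\<forall>phi \<in> cointegrals sc Delta g (V_right sc Delta Lt). phi \<noteq> (\<lambda>_. 0) \<longrightarrow>
            non_degenerate sc Delta Lt \<and> V_right sc Delta Lt = A_alg sc Delta Lt
            \<and> faithful_on phi (V_right sc Delta Lt))
       \<and> ((\<exists>phi \<in> cointegrals sc Delta g (A_alg sc Delta Lt). faithful_on phi (A_alg sc Delta Lt))
            \<longrightarrow> non_degenerate sc Delta Lt)"
proof -
  have "vector_space sc"
    using assms(1) by (simp add: hopf_algebra_def module_iff_vector_space)
  then interpret rel_integral sc Delta eps S Lam Lt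
    using assms(1,3)
    by (simp add: rel_integral_def rel_integral_axioms_def hopf_def hopf_axioms_def)
  note g = assms(4)
  \<comment> \<open>A cointegral on \<open>V\<close> that vanishes at \<open>Lt\<close> is zero, so
    a non-zero one exhibits \<open>g\<close> as a left slice.\<close>
  have in_V_left: "g \<in> V_left sc Delta Lt"
    if "phi \<in> cointegrals sc Delta g V" "phi \<noteq> (\<lambda>_. 0)" for phi
    using group_like_in_V_left_if_cointegral[OF that(1) _ subspace_V_right self_in_V_right]
      cointegral_zero_if_vanishes[OF that(1)] that(2) by blast
  have "cointegrals sc Delta g V = {\<lambda>_. 0}" if "g \<notin> V_left sc Delta Lt"
    using in_V_left that zero_in_cointegrals by blast
  moreover have "non_degenerate sc Delta Lt"
    if "phi \<in> cointegrals sc Delta g A" "faithful_on phi A" for phi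
  proof -
    have "Lt \<in> A" using self_in_V_right V_subset_A by blast
    then have "g \<in> V_left sc Delta Lt"
      using group_like_in_V_left_if_cointegral[OF that(1) _ subspace_A]
        cointegral_nonzero_at_L[OF that] by blast
    then show ?thesis using non_degenerate_if_group_like_in_V_left[OF g] by blast
  qed
  ultimately show ?thesis
    using dim_cointegrals[OF g] in_V_left non_degenerate_if_group_like_in_V_left[OF g]
      faithful_cointegral[OF g] by blast
qed

end
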